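(* Let $G$ be a connected graph with $m$ edges and let $k\geq 2$ be an integer. Then $$\chi'^t_d(P_{k+1})\leq \chi'^t_d(G^{\frac{1}{k}})\leq m\,\chi'^t_d(P_{k+1}),$$ where $P_{k+1}$ is the path graph of order $k+1$ and $G^{\frac1k}$ is the $k$-subdivision of $G$.
   Context: Graphs are simple. Two edges are adjacent if they are distinct and share an endpoint. A total dominator edge coloring (TDE-coloring) of a graph $G$ is a proper edge coloring of $G$ in which each edge of $G$ is adjacent to every edge of some color class (a color class is the set of all edges assigned a given used color). The total dominator edge chromatic number $\chi'^t_d(G)$ is the minimum number of color classes in a TDE-coloring of $G$. The $k$-subdivision $G^{\frac{1}{k}}$ of $G$ is the graph obtained by replacing each edge of $G$ with a path of length $k$ (i.e. with $k$ edges and $k-1$ new internal vertices) between its endpoints. The order of a graph is its number of vertices.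
   Formalization: The formal theorem assumes that G has at least one edge (m ≥ 1); for m = 0, G is a single vertex, its k-subdivision has no edges and number 0, while that of the path of order k+1 is at least 2, so the lower bound fails. *)

theory Defs
  imports Main
begin

record 'a ugraph =
  verts :: "'a set"
  edges :: "'a set set"

definition simple_graph :: "'a ugraph \<Rightarrow> bool" where
  "simple_graph G \<longleftrightarrow>
     finite (verts G) \<and> (\<forall>e\<in>edges G. e \<subseteq> verts G \<and> card e = 2)"

definition connected_graph :: "'a ugraph \<Rightarrow> bool" where
  "connected_graph G \<longleftrightarrow>
     verts G \<noteq> {} \<and>
     (\<forall>u\<in>verts G. \<forall>v\<in>verts G. (u, v) \<in> {(x, y). {x, y} \<in> edges G}\<^sup>*)"

definition adjacent_edges :: "'a set \<Rightarrow> 'a set \<Rightarrow> bool" where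
  "adjacent_edges e f \<longleftrightarrow> e \<noteq> f \<and> e \<inter> f \<noteq> {}"

definition proper_edge_coloring :: "'a ugraph \<Rightarrow> ('a set \<Rightarrow> nat) \<Rightarrow> bool" where
  "proper_edge_coloring G c \<longleftrightarrow>
     (\<forall>e\<in>edges G. \<forall>f\<in>edges G. adjacent_edges e f \<longrightarrow> c e \<noteq> c f)"

definition color_classes :: "'a ugraph \<Rightarrow> ('a set \<Rightarrow> nat) \<Rightarrow> 'a set set set" where
  "color_classes G c = (\<lambda>i. {e \<in> edges G. c e = i}) ` (c ` edges G)"

definition tde_coloring :: "'a ugraph \<Rightarrow> ('a set \<Rightarrow> nat) \<Rightarrow> bool" where
  "tde_coloring G c \<longleftrightarrow>
     proper_edge_coloring G c \<and>
     (\<forall>e\<in>edges G. \<exists>C\<in>color_classes G c. \<forall>f\<in>C. adjacent_edges e f)"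

(* Meaningful only if G has a TDE-coloring; for a finite G this means that every edge
   is adjacent to some edge, see tde_coloring_exists_iff. *)
definition tde_chromatic_number :: "'a ugraph \<Rightarrow> nat" where
  "tde_chromatic_number G =
     (LEAST n. \<exists>c. tde_coloring G c \<and> card (color_classes G c) = n)"

definition path_graph :: "nat \<Rightarrow> nat ugraph" where
  "path_graph n = \<lparr>verts = {..<n}, edges = {{i, Suc i} |i. Suc i < n}\<rparr>"

(* Old v is the vertex v of G; New e i is the i-th internal vertex, 0 < i < k,
   of the path that replaces the edge e. *)
datatype 'a sub_vertex = Old 'a | New "'a set" nat

(* An arbitrary ordering of the two endpoints of an edge. It fixes the direction in which
   the internal vertices are numbered, and so does not affect the subdivision
   up to isomorphism. *)
definition edge_ends :: "'a set \<Rightarrow> 'a \<times> 'a" where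
  "edge_ends e = (SOME p. e = {fst p, snd p})"

definition sub_path :: "nat \<Rightarrow> 'a set \<Rightarrow> nat \<Rightarrow> 'a sub_vertex" where
  "sub_path k e i =
     (if i = 0 then Old (fst (edge_ends e))
      else if i = k then Old (snd (edge_ends e))
      else New e i)"

definition subdivision :: "nat \<Rightarrow> 'a ugraph \<Rightarrow> 'a sub_vertex ugraph" where
  "subdivision k G =
     \<lparr>verts = Old ` verts G \<union> {New e i |e i. e \<in> edges G \<and> 0 < i \<and> i < k},
      edges = {{sub_path k e i, sub_path k e (Suc i)} |e i. e \<in> edges G \<and> i < k}\<rparr>"

lemma edge_ends:
  assumes "card e = 2"
  shows "e = {fst (edge_ends e), snd (edge_ends e)}"
    and "fst (edge_ends e) \<noteq> snd (edge_ends e)"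
proof -
  obtain u v where "e = {u, v}"
    using assms by (auto simp: card_2_iff)
  then have "e = {fst (u, v), snd (u, v)}" by simp
  then show eq: "e = {fst (edge_ends e), snd (edge_ends e)}"
    unfolding edge_ends_def by (rule someI)
  show "fst (edge_ends e) \<noteq> snd (edge_ends e)"
  proof
    assume "fst (edge_ends e) = snd (edge_ends e)"
    with eq have "e = {snd (edge_ends e)}" by simp
    then have "card e = card {snd (edge_ends e)}" by (rule arg_cong)
    with assms show False by simp
  qed
qed

lemma simple_graph_path_graph: "simple_graph (path_graph n)"
  by (auto simp: simple_graph_def path_graph_def)

lemma simple_graph_subdivision:
  assumes "simple_graph G"
  shows "simple_graph (subdivision k G)"
proof -
  have fin: "finite (verts G)" and E: "\<And>e. e \<in> edges G \<Longrightarrow> e \<subseteq> verts G \<and> card e = 2"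
    using assms by (auto simp: simple_graph_def)
  have "edges G \<subseteq> Pow (verts G)" using E by auto
  then have finE: "finite (edges G)" using fin finite_subset by blast
  have "{New e i |e i. e \<in> edges G \<and> 0 < i \<and> i < k}
      \<subseteq> (\<lambda>(e, i). New e i) ` (edges G \<times> {..<k})" by auto
  then have "finite {New e i |e i. e \<in> edges G \<and> 0 < i \<and> i < k}"
    using finE finite_subset by blast
  then have 1: "finite (verts (subdivision k G))"
    using fin by (simp add: subdivision_def)
  have 2: "sub_path k e i \<in> verts (subdivision k G)" if "e \<in> edges G" "i \<le> k" for e i
  proof -
    have "fst (edge_ends e) \<in> verts G" "snd (edge_ends e) \<in> verts G"
      using E[OF that(1)] edge_ends(1)[of e] by blast+
    then show ?thesis using that by (auto simp: sub_path_def subdivision_def)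
  qed
  have 3: "sub_path k e i \<noteq> sub_path k e (Suc i)" if "e \<in> edges G" for e i
    using edge_ends(2)[of e] E[OF that] by (auto simp: sub_path_def)
  have "x \<subseteq> verts (subdivision k G) \<and> card x = 2" if x: "x \<in> edges (subdivision k G)" for x
  proof -
    obtain e i where ei: "x = {sub_path k e i, sub_path k e (Suc i)}" "e \<in> edges G" "i < k"
      using x by (auto simp: subdivision_def)
    have "sub_path k e i \<in> verts (subdivision k G)"
      "sub_path k e (Suc i) \<in> verts (subdivision k G)"
      using 2 ei by auto
    then show ?thesis using 3[OF ei(2), of i] ei(1) by simp
  qed
  with 1 show ?thesis by (simp add: simple_graph_def)
qed

lemma tde_coloring_exists_iff:
  assumes "finite (edges G)"
  shows "(\<exists>c. tde_coloring G c) \<longleftrightarrow> (\<forall>e\<in>edges G. \<exists>f\<in>edges G. adjacent_edges e f)"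
proof
  assume "\<exists>c. tde_coloring G c"
  then obtain c where c: "tde_coloring G c" ..
  show "\<forall>e\<in>edges G. \<exists>f\<in>edges G. adjacent_edges e f"
    using c by (fastforce simp: tde_coloring_def color_classes_def)
next
  assume R: "\<forall>e\<in>edges G. \<exists>f\<in>edges G. adjacent_edges e f"
  obtain c :: "'a set \<Rightarrow> nat" where c: "inj_on c (edges G)"
    using finite_imp_inj_to_nat_seg[OF assms] by blast
  have "proper_edge_coloring G c"
    using c by (auto simp: proper_edge_coloring_def adjacent_edges_def inj_on_def)
  moreover have "\<exists>C\<in>color_classes G c. \<forall>f\<in>C. adjacent_edges e f" if e: "e \<in> edges G" for e
  proof -
    obtain f where f: "f \<in> edges G" "adjacent_edges e f" using R e by blast
    have "{g \<in> edges G. c g = c f} = {f}" using c f by (auto simp: inj_on_def)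
    then have "{f} \<in> color_classes G c" using f by (auto simp: color_classes_def)
    then show ?thesis using f by (intro bexI[of _ "{f}"]) auto
  qed
  ultimately show "\<exists>c. tde_coloring G c" by (auto simp: tde_coloring_def)
qed

end

theory Submission
  imports Defs "HOL-Library.Nat_Bijection"
begin

text \<open>
  Every path that replaces an edge of \<open>G\<close> is a copy of \<open>P\<close>, the path with \<open>k\<close> edges, and the
  edge set of the subdivision is the disjoint union of these \<open>m\<close> copies.

  Upper bound: colour each copy like an optimal colouring of \<open>P\<close>, with a separate palette for
  each copy. Then every colour class lies inside one copy, so the domination that holds in \<open>P\<close>
  survives (\<open>tde_chromatic_number_le_copies\<close>).

  Lower bound: restrict an optimal colouring of the subdivision to a single copy. Only those
  edges of the copy that are dominated exclusively by classes lying outside it cause trouble.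
  Such an edge can be repaired without new colours: the colour of the foreign class
  does not occur on the copy, so it can be given to one neighbour of the
  edge inside the copy, which thereby becomes a singleton class. Two different edges of the copy
  never claim the same foreign colour, because an edge outside the copy meets the copy in at most
  one end vertex and hence is adjacent to at most one edge of it. Giving an edge a private colour
  never harms the others, since the class that it leaves only gets smaller, and if that
  class becomes empty then its place is taken by the new singleton
  (\<open>tde_chromatic_number_le_embedding\<close>).
\<close>

section \<open>Dominating colours\<close>

lemma adjacent_edges_sym: "adjacent_edges e f \<Longrightarrow> adjacent_edges f e"
  by (auto simp: adjacent_edges_def)

lemma card_color_classes: "card (color_classes G c) = card (c ` edges G)"
  unfolding color_classes_def by (rule card_image) (auto simp: inj_on_def)

text \<open>A colour class is nonempty, so it can be named by one of its edges; the
  proofs below transport such representatives along maps of edges.\<close>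

lemma tde_coloring_iff:
  "tde_coloring G c \<longleftrightarrow> proper_edge_coloring G c \<and>
    (\<forall>e\<in>edges G. \<exists>d\<in>edges G. \<forall>f\<in>edges G. c f = c d \<longrightarrow> adjacent_edges e f)"
  by (simp add: tde_coloring_def color_classes_def Ball_def imp_conjL)

lemma tde_chromatic_number_le:
  assumes "tde_coloring G c"
  shows "tde_chromatic_number G \<le> card (c ` edges G)"
  unfolding tde_chromatic_number_def
  by (rule Least_le) (use assms card_color_classes in blast)

lemma optimal_tde_coloring:
  assumes "tde_coloring G c\<^sub>0"
  obtains c where "tde_coloring G c" "card (c ` edges G) = tde_chromatic_number G"
proof -
  have "\<exists>c. tde_coloring G c \<and> card (color_classes G c) = tde_chromatic_number G"
    unfolding tde_chromatic_number_def by (rule LeastI_ex) (use assms in blast)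
  then show thesis using that by (auto simp: card_color_classes)
qed

section \<open>Restriction to an embedded graph\<close>

text \<open>The separation hypothesis makes the foreign colours claimed by different edges
  distinct, so that the neighbours recoloured with them become singleton classes.\<close>

lemma tde_chromatic_number_le_embedding:
  fixes P :: "'b ugraph" and H :: "'a ugraph" and h :: "'b set \<Rightarrow> 'a set"
  assumes fin: "finite (edges H)"
    and into: "h ` edges P \<subseteq> edges H"
    and adj: "\<And>p q. \<lbrakk>p \<in> edges P; q \<in> edges P\<rbrakk> \<Longrightarrow>
                adjacent_edges (h p) (h q) \<longleftrightarrow> adjacent_edges p q"
    and noniso: "\<And>p. p \<in> edges P \<Longrightarrow> \<exists>q\<in>edges P. adjacent_edges p q"
    and separated: "\<And>x p q. \<lbrakk>x \<in> edges H - h ` edges P; p \<in> edges P; q \<in> edges P;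
                adjacent_edges x (h p); adjacent_edges x (h q)\<rbrakk> \<Longrightarrow> p = q"
    and colorable: "tde_coloring H c\<^sub>0"
  shows "tde_chromatic_number P \<le> tde_chromatic_number H"
proof -
  let ?E = "edges P"
  obtain c where c: "tde_coloring H c" and opt: "card (c ` edges H) = tde_chromatic_number H"
    using optimal_tde_coloring[OF colorable] .
  have proper: "\<And>e f. \<lbrakk>e \<in> edges H; f \<in> edges H; adjacent_edges e f\<rbrakk> \<Longrightarrow> c e \<noteq> c f"
    using c by (auto simp: tde_coloring_def proper_edge_coloring_def)
  have "\<forall>p\<in>?E. \<exists>d\<in>edges H. \<forall>f\<in>edges H. c f = c d \<longrightarrow> adjacent_edges (h p) f"
    using c into unfolding tde_coloring_iff by blast
  then obtain D where D: "\<And>p. p \<in> ?E \<Longrightarrow> D p \<in> edges H"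
    and D_adj: "\<And>p f. \<lbrakk>p \<in> ?E; f \<in> edges H; c f = c (D p)\<rbrakk> \<Longrightarrow> adjacent_edges (h p) f"
    by metis
  obtain n where n: "\<And>p. p \<in> ?E \<Longrightarrow> n p \<in> ?E"
    and n_adj: "\<And>p. p \<in> ?E \<Longrightarrow> adjacent_edges p (n p)"
    using noniso by metis
  \<comment> \<open>If the dominating class of an edge meets the copy of \<open>P\<close>, its part in the copy still dominates
    the edge; only the remaining edges need a repair.\<close>
  define Bad where "Bad = {p \<in> ?E. c (D p) \<notin> c ` h ` ?E}"
  define R where "R = n ` Bad"
  \<comment> \<open>A neighbour shared by several bad edges takes one of their foreign colours; any one
    serves all of them, since its class is a singleton anyway.\<close>
  define c' where "c' q = (if q \<in> R then c (D (inv_into Bad n q)) else c (h q))" for q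
  have foreign_inj: "p = q" if "p \<in> Bad" "q \<in> Bad" "c (D p) = c (D q)" for p q
  proof -
    have pq: "p \<in> ?E" "q \<in> ?E" using that by (auto simp: Bad_def)
    have "D p \<notin> h ` ?E" using that(1) by (auto simp: Bad_def)
    moreover have "adjacent_edges (D p) (h p)" "adjacent_edges (D p) (h q)"
      using D_adj D pq that(3) adjacent_edges_sym by metis+
    ultimately show ?thesis using separated D pq by blast
  qed
  have R: "inv_into Bad n q \<in> Bad" "n (inv_into Bad n q) = q" if "q \<in> R" for q
    using that unfolding R_def by (rule inv_into_into, rule f_inv_into_f)
  have singleton: "r = q" if "q \<in> R" "r \<in> ?E" "c' r = c' q" for q r
  proof (cases "r \<in> R")
    case True
    then have "inv_into Bad n r = inv_into Bad n q"
      using that foreign_inj R by (simp add: c'_def)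
    then show ?thesis using R that(1) True by metis
  next
    case False
    then have "c (D (inv_into Bad n q)) = c (h r)"
      using that by (simp add: c'_def)
    then have "c (D (inv_into Bad n q)) \<in> c ` h ` ?E"
      using that(2) by simp
    then show ?thesis using R(1)[OF that(1)] by (auto simp: Bad_def)
  qed
  have c'_proper: "c' p \<noteq> c' q" if pq: "p \<in> ?E" "q \<in> ?E" "adjacent_edges p q" for p q
  proof
    assume eq: "c' p = c' q"
    have "p \<noteq> q" using pq(3) by (auto simp: adjacent_edges_def)
    then have "p \<notin> R" "q \<notin> R" using singleton pq eq by metis+
    then have "c (h p) = c (h q)" using eq by (simp add: c'_def)
    then show False using proper adj pq into by blast
  qed
  have c'_dom: "\<exists>d\<in>?E. \<forall>f\<in>?E. c' f = c' d \<longrightarrow> adjacent_edges p f" if p: "p \<in> ?E" for p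
  proof (cases "p \<in> Bad")
    case True
    then have "n p \<in> R" by (simp add: R_def)
    then show ?thesis using singleton n n_adj p by metis
  next
    case False
    then obtain d where d: "d \<in> ?E" "c (h d) = c (D p)" using p by (auto simp: Bad_def)
    have near: "adjacent_edges p f" if "f \<in> ?E" "c (h f) = c (D p)" for f
      using D_adj[OF p] that into adj[OF p that(1)] by blast
    have "adjacent_edges p f" if f: "f \<in> ?E" "c' f = c' d" for f
    proof (cases "d \<in> R \<or> f \<in> R")
      case True
      then have "f = d" using singleton f d by metis
      then show ?thesis using near d by blast
    next
      case False
      then show ?thesis using near f d by (simp add: c'_def)
    qed
    then show ?thesis using d by blast
  qed
  have "tde_coloring P c'"
    using c'_proper c'_dom by (auto simp: tde_coloring_iff proper_edge_coloring_def)
  then have "tde_chromatic_number P \<le> card (c' ` ?E)" by (rule tde_chromatic_number_le)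
  also have "c' ` ?E \<subseteq> c ` edges H"
    using R(1) D into by (auto simp: c'_def Bad_def)
  then have "card (c' ` ?E) \<le> card (c ` edges H)"
    using fin by (intro card_mono) auto
  finally show ?thesis by (simp add: opt)
qed

section \<open>Disjoint copies\<close>

text \<open>Pairing the index of the copy with the colour in \<open>P\<close> keeps the palettes apart. The colourability
  of \<open>H\<close> is part of the conclusion because without it the chromatic number has no meaning.\<close>

lemma tde_chromatic_number_le_copies:
  fixes P :: "'b ugraph" and H :: "'a ugraph" and h :: "'i \<Rightarrow> 'b set \<Rightarrow> 'a set"
  assumes finI: "finite I" and finP: "finite (edges P)"
    and cover: "edges H = (\<Union>i\<in>I. h i ` edges P)"
    and inj: "\<And>i j p q. \<lbrakk>i \<in> I; j \<in> I; p \<in> edges P; q \<in> edges P; h i p = h j q\<rbrakk> \<Longrightarrow> i = j \<and> p = q"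
    and adj: "\<And>i p q. \<lbrakk>i \<in> I; p \<in> edges P; q \<in> edges P\<rbrakk> \<Longrightarrow>
                adjacent_edges (h i p) (h i q) \<longleftrightarrow> adjacent_edges p q"
    and colorable: "tde_coloring P c\<^sub>0"
  shows "(\<exists>c. tde_coloring H c) \<and> tde_chromatic_number H \<le> card I * tde_chromatic_number P"
proof -
  obtain c where c: "tde_coloring P c" and opt: "card (c ` edges P) = tde_chromatic_number P"
    using optimal_tde_coloring[OF colorable] .
  obtain ix :: "'i \<Rightarrow> nat" where ix: "inj_on ix I"
    using finite_imp_inj_to_nat_seg[OF finI] by blast
  define g where "g = (\<lambda>(i, p). h i p)"
  have g_inj: "inj_on g (I \<times> edges P)"
    using inj by (auto simp: g_def inj_on_def)
  define col where "col x = (case inv_into (I \<times> edges P) g x of (i, p) \<Rightarrow> prod_encode (ix i, c p))" for x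
  have col: "col (h i p) = prod_encode (ix i, c p)" if "i \<in> I" "p \<in> edges P" for i p
    using inv_into_f_f[OF g_inj, of "(i, p)"] that by (simp add: col_def g_def)
  have col_eq: "i = j \<and> c p = c q"
    if "i \<in> I" "j \<in> I" "p \<in> edges P" "q \<in> edges P" "col (h i p) = col (h j q)" for i j p q
    using that ix by (auto simp: col inj_on_def)
  have "col x \<noteq> col y" if xy: "x \<in> edges H" "y \<in> edges H" "adjacent_edges x y" for x y
  proof
    assume eq: "col x = col y"
    obtain i p where ip: "i \<in> I" "p \<in> edges P" "x = h i p" using xy cover by auto
    obtain j q where jq: "j \<in> I" "q \<in> edges P" "y = h j q" using xy cover by auto
    have "i = j" "c p = c q" using col_eq eq ip jq by blast+
    moreover from \<open>i = j\<close> have "adjacent_edges p q" using adj ip jq xy(3) by blast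
    ultimately show False
      using c ip jq by (auto simp: tde_coloring_def proper_edge_coloring_def)
  qed
  then have "proper_edge_coloring H col" by (simp add: proper_edge_coloring_def)
  moreover have "\<exists>d\<in>edges H. \<forall>f\<in>edges H. col f = col d \<longrightarrow> adjacent_edges e f"
    if e: "e \<in> edges H" for e
  proof -
    obtain i p where ip: "i \<in> I" "p \<in> edges P" "e = h i p" using e cover by auto
    obtain d where d: "d \<in> edges P" "\<forall>f\<in>edges P. c f = c d \<longrightarrow> adjacent_edges p f"
      using c ip(2) unfolding tde_coloring_iff by blast
    have "adjacent_edges e f" if f: "f \<in> edges H" "col f = col (h i d)" for f
    proof -
      obtain j q where jq: "j \<in> I" "q \<in> edges P" "f = h j q" using f cover by auto
      then have "j = i" "c q = c d" using col_eq f ip d by blast+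
      then show ?thesis using jq ip d adj by auto
    qed
    then show ?thesis using ip d cover by blast
  qed
  ultimately have tde: "tde_coloring H col" by (simp add: tde_coloring_iff)
  have "col ` edges H \<subseteq> prod_encode ` (ix ` I \<times> c ` edges P)"
    by (auto simp: cover col)
  then have "card (col ` edges H) \<le> card (prod_encode ` (ix ` I \<times> c ` edges P))"
    using finI finP by (intro card_mono) auto
  also have "\<dots> \<le> card (ix ` I \<times> c ` edges P)"
    using finI finP by (intro card_image_le) auto
  also have "\<dots> = card I * tde_chromatic_number P"
    using ix opt by (simp add: card_cartesian_product card_image)
  finally show ?thesis
    using tde tde_chromatic_number_le[OF tde] by (meson le_trans)
qed

section \<open>The copies of a path in a subdivision\<close>

lemma adjacent_edges_image:
  assumes "inj_on f V" "p \<subseteq> V" "q \<subseteq> V"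
  shows "adjacent_edges (f ` p) (f ` q) \<longleftrightarrow> adjacent_edges p q"
  using assms
  by (simp add: adjacent_edges_def inj_on_image_eq_iff inj_on_image_Int[symmetric])

lemma edges_path_graph: "edges (path_graph (Suc k)) = (\<lambda>i. {i, Suc i}) ` {..<k}"
  by (auto simp: path_graph_def)

lemma path_graph_no_isolated_edge:
  assumes "k \<ge> 2" "p \<in> edges (path_graph (k + 1))"
  shows "\<exists>q\<in>edges (path_graph (k + 1)). adjacent_edges p q"
proof -
  obtain i where i: "i < k" "p = {i, Suc i}" using assms(2) by (auto simp: edges_path_graph)
  show ?thesis
  proof (cases i)
    case 0
    then have "adjacent_edges p {1, Suc 1}" using i by (auto simp: adjacent_edges_def doubleton_eq_iff)
    then show ?thesis using assms(1) by (auto simp: edges_path_graph)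
  next
    case (Suc j)
    then have "adjacent_edges p {j, Suc j}" using i by (auto simp: adjacent_edges_def doubleton_eq_iff)
    then show ?thesis using i Suc by (auto simp: edges_path_graph)
  qed
qed

lemma edges_subdivision:
  "edges (subdivision k G) = (\<Union>e\<in>edges G. (`) (sub_path k e) ` edges (path_graph (k + 1)))"
  by (simp add: subdivision_def edges_path_graph image_image) blast

lemma inj_on_sub_path:
  assumes "card e = 2"
  shows "inj_on (sub_path k e) {..k}"
  using edge_ends(2)[OF assms] by (auto simp: inj_on_def sub_path_def split: if_splits)

text \<open>For \<open>k \<ge> 2\<close> no path edge joins both ends of the path. The internal vertex identifies the copy
  that the edge belongs to and leaves room for at most one vertex of \<open>G\<close>.\<close>

lemma sub_path_image_edge:
  assumes "k \<ge> 2" "p \<in> edges (path_graph (k + 1))"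
  obtains j a where "sub_path k e ` p = {New e j, a}"
proof -
  obtain i where i: "i < k" "p = {i, Suc i}" using assms(2) by (auto simp: edges_path_graph)
  show thesis
  proof (cases i)
    case 0
    then have "sub_path k e ` p = {New e 1, sub_path k e 0}"
      using i assms(1) by (auto simp: sub_path_def)
    then show thesis by (rule that)
  next
    case (Suc j)
    then have "sub_path k e ` p = {New e i, sub_path k e (Suc i)}"
      using i by (auto simp: sub_path_def)
    then show thesis by (rule that)
  qed
qed

lemma sub_path_New: "New d j = sub_path k e i \<Longrightarrow> d = e"
  by (auto simp: sub_path_def split: if_splits)

lemma sub_path_edges_disjoint:
  assumes "k \<ge> 2" "p \<in> edges (path_graph (k + 1))" "sub_path k d ` p = sub_path k e ` q"
  shows "d = e"
proof -
  obtain j a where "sub_path k d ` p = {New d j, a}"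
    using sub_path_image_edge assms(1,2) .
  then have "New d j \<in> sub_path k e ` q" using assms(3) by auto
  then show ?thesis using sub_path_New by (metis imageE)
qed

text \<open>Two copies share only end vertices, and an end vertex of a path lies on only one
  of its edges. As an edge of the copy \<open>d\<close> has at most one vertex in \<open>G\<close>, it reaches the copy \<open>e\<close>
  through at most one end.\<close>

lemma sub_path_separated:
  assumes k: "k \<ge> 2" and e: "card e = 2" and "d \<noteq> e"
    and r: "r \<in> edges (path_graph (k + 1))"
    and p: "p \<in> edges (path_graph (k + 1))" and q: "q \<in> edges (path_graph (k + 1))"
    and adj: "adjacent_edges (sub_path k d ` r) (sub_path k e ` p)"
             "adjacent_edges (sub_path k d ` r) (sub_path k e ` q)"
  shows "p = q"
proof -
  obtain j a where ja: "sub_path k d ` r = {New d j, a}"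
    using sub_path_image_edge k r .
  have new: "New d j \<notin> sub_path k e ` s" for s
    using sub_path_New \<open>d \<noteq> e\<close> by (metis imageE)
  have "a \<in> sub_path k e ` p" "a \<in> sub_path k e ` q"
    using adj new ja by (auto simp: adjacent_edges_def)
  then obtain x y where xy: "x \<in> p" "y \<in> q" "a = sub_path k e x" "a = sub_path k e y" by auto
  have le: "x \<le> k" "y \<le> k" using xy p q by (auto simp: edges_path_graph)
  then have "x = y" using inj_on_sub_path[OF e] xy by (auto simp: inj_on_def)
  have "a \<in> sub_path k d ` r" using ja by simp
  then have "x = 0 \<or> x = k"
    using xy(3) \<open>d \<noteq> e\<close> by (auto simp: sub_path_def split: if_splits)
  then show ?thesis using xy \<open>x = y\<close> p q by (auto simp: edges_path_graph)
qed

section \<open>The bounds\<close>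

theorem theorem4p2:
  fixes G :: "'a ugraph" and k m :: nat
  assumes "simple_graph G"
    and "connected_graph G"
    and "card (edges G) = m"
    and "m \<ge> 1"
    and "k \<ge> 2"
  shows "tde_chromatic_number (path_graph (k + 1))
           \<le> tde_chromatic_number (subdivision k G)
         \<and> tde_chromatic_number (subdivision k G)
           \<le> m * tde_chromatic_number (path_graph (k + 1))"
proof -
  let ?P = "path_graph (k + 1)" and ?H = "subdivision k G"
  let ?h = "\<lambda>e p. sub_path k e ` p"
  have card2: "card e = 2" if "e \<in> edges G" for e
    using assms(1) that by (simp add: simple_graph_def)
  have finG: "finite (edges G)" using assms(3,4) card.infinite by fastforce
  have finP: "finite (edges ?P)" by (simp add: edges_path_graph)
  have finH: "finite (edges ?H)" using finG finP by (simp add: edges_subdivision)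
  have subset: "p \<subseteq> {..k}" if "p \<in> edges ?P" for p
    using that by (auto simp: edges_path_graph)
  have adj: "adjacent_edges (?h e p) (?h e q) \<longleftrightarrow> adjacent_edges p q"
    if "e \<in> edges G" "p \<in> edges ?P" "q \<in> edges ?P" for e p q
    using that adjacent_edges_image[OF inj_on_sub_path[OF card2]] subset by blast
  have inj: "d = e \<and> p = q"
    if "d \<in> edges G" "e \<in> edges G" "p \<in> edges ?P" "q \<in> edges ?P" "?h d p = ?h e q" for d e p q
  proof -
    have "d = e" using sub_path_edges_disjoint[OF \<open>k \<ge> 2\<close>] that by blast
    moreover have "p = q"
      using inj_on_image_eq_iff[OF inj_on_sub_path[OF card2]] that subset calculation by metis
    ultimately show ?thesis by blast
  qed
  obtain c where c: "tde_coloring ?P c"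
    using tde_coloring_exists_iff[OF finP] path_graph_no_isolated_edge[OF \<open>k \<ge> 2\<close>] by blast
  have upper: "(\<exists>c. tde_coloring ?H c) \<and>
      tde_chromatic_number ?H \<le> card (edges G) * tde_chromatic_number ?P"
    by (rule tde_chromatic_number_le_copies[OF finG finP edges_subdivision inj adj c])
  then obtain c\<^sub>H where c\<^sub>H: "tde_coloring ?H c\<^sub>H" by blast
  obtain e where e: "e \<in> edges G" using assms(3,4) by fastforce
  have "tde_chromatic_number ?P \<le> tde_chromatic_number ?H"
  proof (rule tde_chromatic_number_le_embedding[OF finH _ _ _ _ c\<^sub>H, where h = "?h e"])
    show "?h e ` edges ?P \<subseteq> edges ?H" using e by (auto simp: edges_subdivision)
    fix x p q
    assume x: "x \<in> edges ?H - ?h e ` edges ?P" and pq: "p \<in> edges ?P" "q \<in> edges ?P"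
      and "adjacent_edges x (?h e p)" "adjacent_edges x (?h e q)"
    moreover obtain d r where "r \<in> edges ?P" "x = ?h d r" "d \<noteq> e"
      using x by (auto simp: edges_subdivision)
    ultimately show "p = q" using sub_path_separated[OF \<open>k \<ge> 2\<close> card2[OF e]] by blast
  qed (use adj e path_graph_no_isolated_edge[OF \<open>k \<ge> 2\<close>] in blast)+
  with upper show ?thesis using assms(3) by simp
qed

end
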